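(* Let $(X,\widehat d_X)$ and $(Y,\widehat d_Y)$ be two non-Archimedean metric spaces. (1) For any maps $f,g\in\mathfrak M(X\to Y)$, $$\widehat\rho_H(f,g)\le\widehat\rho_s(f,g)\le\max\{\theta_{f,g}(\widehat\rho_H(f,g))^{+},\ \widehat\rho_H(f,g)\},$$ and $$\theta_{f,g}(\widehat\rho_H(f,g))^{+}\le\widehat\rho_H(f,g)+\min\{\operatorname{dis} f,\ \operatorname{dis} g\}.$$ (2) Let $f_n\in\mathfrak M(X\to Y)$ $(n=1,2,\dots)$ and let $g\in\mathfrak C_u(X\to Y)$. Then the sequence $\{f_n\}_{n=1}^\infty$ converges uniformly to $g$ if and only if $\lim_{n\to\infty}\widehat\rho_H(f_n,g)=0$.
   Context: Metrics may take the value $+\infty$. A metric $\widehat d$ is non-Archimedean if $\widehat d(x,z)\le\max\{\widehat d(x,y),\widehat d(y,z)\}$ for all $x,y,z$. $\mathfrak M(X\to Y)$ is the set of all maps $X\to Y$, and $\mathfrak C_u(X\to Y)$ is the set of all uniformly continuous maps $X\to Y$. In a metric space $(Z,d)$, $\operatorname{dist}(x,A)=\inf_{a\in A}d(x,a)$, and the Hausdorff distance of subsets is $d_H(A,B)=\max\{\sup_{a\in A}\operatorname{dist}(a,B),\ \sup_{b\in B}\operatorname{dist}(b,A)\}$. On $Z=X\times Y$ use the non-Archimedean metric $\widehat d_Z((x_1,y_1),(x_2,y_2))=\max\{\widehat d_X(x_1,x_2),\widehat d_Y(y_1,y_2)\}$, with Hausdorff distance $\widehat d_{Z,H}$. For $f\in\mathfrak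 M(X\to Y)$ its graph is $\Gamma_f=\{(x,f(x)):x\in X\}\subset Z$. Define $$\widehat\rho_H(f,g)=\widehat d_{Z,H}(\Gamma_f,\Gamma_g),\qquad \widehat\rho_s(f,g)=\sup_{x\in X}\widehat d_Y(f(x),g(x)).$$ For real $\varepsilon>0$, $\theta_f(\varepsilon)=\sup\{\widehat d_Y(f(x_1),f(x_2)):x_1,x_2\in X,\ \widehat d_X(x_1,x_2)<\varepsilon\}$ and $\theta_{f,g}(\varepsilon)=\min\{\theta_f(\varepsilon),\theta_g(\varepsilon)\}$. For real $a\ge0$, $\theta_{f,g}(a)^{+}=\lim_{\varepsilon\to a^{+}}\theta_{f,g}(\varepsilon)$ (right-hand limit, in $[0,+\infty]$); put $\theta_{f,g}(+\infty)^{+}=+\infty$. The distortion of $f$ is $\operatorname{dis} f=\sup_{x_1,x_2\in X}|\widehat d_Y(f(x_1),f(x_2))-\widehat d_X(x_1,x_2)|$ (with $|\infty-\infty|=0$). *)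

theory Defs
  imports "HOL-Library.Extended_Nonnegative_Real" "HOL-Library.FuncSet"
begin

text \<open>
  Metrics take values in \<open>[0, \<infinity>]\<close>, so the real-valued \<open>Metric_space\<close> of the library does not
  apply. Spaces are carrier sets, possibly empty; suprema and infima are taken in \<open>ennreal\<close>, so
  the supremum of the empty set is \<open>0\<close> and its infimum is \<open>\<infinity>\<close>.
  A map from \<open>X\<close> to \<open>Y\<close> is a function in \<open>X \<rightarrow> Y\<close>; its values outside \<open>X\<close> are never used.
\<close>

locale ext_metric =
  fixes M :: "'a set" and d :: "'a \<Rightarrow> 'a \<Rightarrow> ennreal"
  assumes zero_iff: "\<lbrakk>x \<in> M; y \<in> M\<rbrakk> \<Longrightarrow> d x y = 0 \<longleftrightarrow> x = y"
    and commute: "\<lbrakk>x \<in> M; y \<in> M\<rbrakk> \<Longrightarrow> d x y = d y x"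
    and triangle: "\<lbrakk>x \<in> M; y \<in> M; z \<in> M\<rbrakk> \<Longrightarrow> d x z \<le> d x y + d y z"

locale nonarch_metric = ext_metric +
  assumes ultrametric: "\<lbrakk>x \<in> M; y \<in> M; z \<in> M\<rbrakk> \<Longrightarrow> d x z \<le> max (d x y) (d y z)"

definition set_dist :: "('a \<Rightarrow> 'a \<Rightarrow> ennreal) \<Rightarrow> 'a \<Rightarrow> 'a set \<Rightarrow> ennreal" where
  "set_dist d x A = (INF a\<in>A. d x a)"

definition hausdorff_dist :: "('a \<Rightarrow> 'a \<Rightarrow> ennreal) \<Rightarrow> 'a set \<Rightarrow> 'a set \<Rightarrow> ennreal" where
  "hausdorff_dist d A B = max (SUP a\<in>A. set_dist d a B) (SUP b\<in>B. set_dist d b A)"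

definition prod_metric ::
    "('a \<Rightarrow> 'a \<Rightarrow> ennreal) \<Rightarrow> ('b \<Rightarrow> 'b \<Rightarrow> ennreal) \<Rightarrow> 'a \<times> 'b \<Rightarrow> 'a \<times> 'b \<Rightarrow> ennreal" where
  "prod_metric dX dY p q = max (dX (fst p) (fst q)) (dY (snd p) (snd q))"

definition graph_on :: "'a set \<Rightarrow> ('a \<Rightarrow> 'b) \<Rightarrow> ('a \<times> 'b) set" where
  "graph_on X f = {(x, f x) | x. x \<in> X}"

definition rho_H ::
    "'a set \<Rightarrow> ('a \<Rightarrow> 'a \<Rightarrow> ennreal) \<Rightarrow> ('b \<Rightarrow> 'b \<Rightarrow> ennreal) \<Rightarrow> ('a \<Rightarrow> 'b) \<Rightarrow> ('a \<Rightarrow> 'b) \<Rightarrow> ennreal" where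
  "rho_H X dX dY f g = hausdorff_dist (prod_metric dX dY) (graph_on X f) (graph_on X g)"

definition rho_s ::
    "'a set \<Rightarrow> ('b \<Rightarrow> 'b \<Rightarrow> ennreal) \<Rightarrow> ('a \<Rightarrow> 'b) \<Rightarrow> ('a \<Rightarrow> 'b) \<Rightarrow> ennreal" where
  "rho_s X dY f g = (SUP x\<in>X. dY (f x) (g x))"

definition theta ::
    "'a set \<Rightarrow> ('a \<Rightarrow> 'a \<Rightarrow> ennreal) \<Rightarrow> ('b \<Rightarrow> 'b \<Rightarrow> ennreal) \<Rightarrow> ('a \<Rightarrow> 'b) \<Rightarrow> real \<Rightarrow> ennreal" where
  "theta X dX dY f \<epsilon> = Sup {dY (f x1) (f x2) | x1 x2. x1 \<in> X \<and> x2 \<in> X \<and> dX x1 x2 < ennreal \<epsilon>}"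

definition theta_min ::
    "'a set \<Rightarrow> ('a \<Rightarrow> 'a \<Rightarrow> ennreal) \<Rightarrow> ('b \<Rightarrow> 'b \<Rightarrow> ennreal) \<Rightarrow> ('a \<Rightarrow> 'b) \<Rightarrow> ('a \<Rightarrow> 'b) \<Rightarrow> real \<Rightarrow> ennreal"
  where "theta_min X dX dY f g \<epsilon> = min (theta X dX dY f \<epsilon>) (theta X dX dY g \<epsilon>)"

text \<open>\<open>theta_min\<close> is monotone in \<open>\<epsilon>\<close>, so the right-hand limit below exists in \<open>[0, \<infinity>]\<close>.\<close>

definition theta_plus ::
    "'a set \<Rightarrow> ('a \<Rightarrow> 'a \<Rightarrow> ennreal) \<Rightarrow> ('b \<Rightarrow> 'b \<Rightarrow> ennreal) \<Rightarrow> ('a \<Rightarrow> 'b) \<Rightarrow> ('a \<Rightarrow> 'b) \<Rightarrow> ennreal \<Rightarrow> ennreal"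
  where "theta_plus X dX dY f g a =
    (if a = \<infinity> then \<infinity> else Lim (at_right (enn2real a)) (theta_min X dX dY f g))"

text \<open>
  The absolute difference in \<open>[0, \<infinity>]\<close>. Subtraction on \<open>ennreal\<close> is truncated, hence the maximum;
  it also satisfies \<open>\<infinity> - \<infinity> = \<infinity>\<close>, hence the separate case giving \<open>|\<infinity> - \<infinity>| = 0\<close>.
\<close>

definition abs_diff :: "ennreal \<Rightarrow> ennreal \<Rightarrow> ennreal" where
  "abs_diff a b = (if a = b then 0 else max (a - b) (b - a))"

definition distortion ::
    "'a set \<Rightarrow> ('a \<Rightarrow> 'a \<Rightarrow> ennreal) \<Rightarrow> ('b \<Rightarrow> 'b \<Rightarrow> ennreal) \<Rightarrow> ('a \<Rightarrow> 'b) \<Rightarrow> ennreal" where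
  "distortion X dX dY f = (SUP x1\<in>X. SUP x2\<in>X. abs_diff (dY (f x1) (f x2)) (dX x1 x2))"

definition unif_cont_maps ::
    "'a set \<Rightarrow> ('a \<Rightarrow> 'a \<Rightarrow> ennreal) \<Rightarrow> 'b set \<Rightarrow> ('b \<Rightarrow> 'b \<Rightarrow> ennreal) \<Rightarrow> ('a \<Rightarrow> 'b) set" where
  "unif_cont_maps X dX Y dY = {f \<in> X \<rightarrow> Y. \<forall>\<epsilon>::real. \<epsilon> > 0 \<longrightarrow> (\<exists>\<delta>::real. \<delta> > 0 \<and>
     (\<forall>x1\<in>X. \<forall>x2\<in>X. dX x1 x2 < ennreal \<delta> \<longrightarrow> dY (f x1) (f x2) < ennreal \<epsilon>))}"

definition converges_uniformly ::
    "'a set \<Rightarrow> ('b \<Rightarrow> 'b \<Rightarrow> ennreal) \<Rightarrow> (nat \<Rightarrow> 'a \<Rightarrow> 'b) \<Rightarrow> ('a \<Rightarrow> 'b) \<Rightarrow> bool" where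
  "converges_uniformly X dY F g \<longleftrightarrow>
     (\<forall>\<epsilon>::real. \<epsilon> > 0 \<longrightarrow> (\<exists>N. \<forall>n\<ge>N. \<forall>x\<in>X. dY (F n x) (g x) < ennreal \<epsilon>))"

end

theory Submission
  imports Defs
begin

text \<open>
  Everything rests on one consequence of \<open>rho_H X dX dY f g < e\<close> (lemma \<open>rho_H_close_point\<close>): each
  point \<open>(x, f x)\<close> has a point \<open>(x', g x')\<close> with \<open>dX x x' < e\<close> and \<open>dY (f x) (g x') < e\<close>. The
  strong triangle inequality in \<open>Y\<close> then bounds \<open>dY (f x) (g x)\<close> by the larger of \<open>e\<close> and
  \<open>dY (g x') (g x)\<close>, an oscillation of \<open>g\<close> over a distance less than \<open>e\<close>. Exchanging \<open>f\<close> and \<open>g\<close>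
  replaces this oscillation by one of \<open>f\<close>, so the smaller of the two moduli suffices.

  For real \<open>e\<close> this reads \<open>rho_s \<le> max e (theta_min e)\<close> whenever \<open>e > rho_H\<close>, and letting \<open>e\<close>
  decrease to \<open>rho_H\<close> gives the upper bound for \<open>rho_s\<close>. The bound by the distortion is the same
  limit applied to \<open>theta_min e \<le> e + min (dis f) (dis g)\<close>. For uniform convergence, uniform
  continuity of \<open>g\<close> controls the oscillation term directly; the other direction follows from
  \<open>rho_H \<le> rho_s\<close>.
\<close>

section \<open>Hausdorff distance of graphs and the supremum distance\<close>

lemma hausdorff_dist_commute: "hausdorff_dist d A B = hausdorff_dist d B A"
  unfolding hausdorff_dist_def by (rule max.commute)

lemma rho_H_commute: "rho_H X dX dY f g = rho_H X dX dY g f"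
  unfolding rho_H_def by (rule hausdorff_dist_commute)

lemma hausdorff_dist_close_point:
  assumes "hausdorff_dist d A B < e" "a \<in> A"
  obtains b where "b \<in> B" "d a b < e"
proof -
  have "set_dist d a B \<le> hausdorff_dist d A B"
    unfolding hausdorff_dist_def using assms(2) by (intro max.coboundedI1 SUP_upper)
  with assms(1) have "(INF b\<in>B. d a b) < e"
    by (simp add: set_dist_def)
  with that show ?thesis by (auto simp: INF_less_iff)
qed

lemma rho_H_close_point:
  assumes "rho_H X dX dY f g < e" "x \<in> X"
  obtains x' where "x' \<in> X" "dX x x' < e" "dY (f x) (g x') < e"
proof -
  have "(x, f x) \<in> graph_on X f"
    using assms(2) by (auto simp: graph_on_def)
  from hausdorff_dist_close_point[OF assms(1)[unfolded rho_H_def] this]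
  obtain b where "b \<in> graph_on X g" "prod_metric dX dY (x, f x) b < e" .
  with that show ?thesis by (auto simp: graph_on_def prod_metric_def)
qed

text \<open>The point of the other graph over the same \<open>x\<close> is a competitor in the infimum, and its
  horizontal distance vanishes.\<close>

lemma set_dist_graph_le_rho_s:
  assumes "ext_metric X dX" "x \<in> X"
  shows "set_dist (prod_metric dX dY) (x, f x) (graph_on X g) \<le> rho_s X dY f g"
proof -
  have "set_dist (prod_metric dX dY) (x, f x) (graph_on X g)
      \<le> prod_metric dX dY (x, f x) (x, g x)"
    unfolding set_dist_def using assms(2) by (intro INF_lower) (auto simp: graph_on_def)
  also have "\<dots> = dY (f x) (g x)"
    using ext_metric.zero_iff[OF assms(1,2,2)] by (simp add: prod_metric_def)
  also have "\<dots> \<le> rho_s X dY f g"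
    unfolding rho_s_def using assms(2) by (rule SUP_upper)
  finally show ?thesis .
qed

lemma rho_s_commute:
  assumes "ext_metric Y dY" "f \<in> X \<rightarrow> Y" "g \<in> X \<rightarrow> Y"
  shows "rho_s X dY f g = rho_s X dY g f"
  unfolding rho_s_def using assms by (intro SUP_cong) (auto intro: ext_metric.commute)

lemma rho_H_le_rho_s:
  assumes X: "ext_metric X dX" and Y: "ext_metric Y dY" and "f \<in> X \<rightarrow> Y" "g \<in> X \<rightarrow> Y"
  shows "rho_H X dX dY f g \<le> rho_s X dY f g"
  unfolding rho_H_def hausdorff_dist_def
  using set_dist_graph_le_rho_s[OF X, of _ dY f g] set_dist_graph_le_rho_s[OF X, of _ dY g f]
    rho_s_commute[OF Y assms(3,4)]
  by (auto simp: graph_on_def intro!: SUP_least)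

section \<open>The modulus of continuity and its right-hand limit\<close>

lemma theta_upper:
  assumes "x1 \<in> X" "x2 \<in> X" "dX x1 x2 < ennreal e"
  shows "dY (f x1) (f x2) \<le> theta X dX dY f e"
  unfolding theta_def using assms by (intro Sup_upper) blast

lemma mono_theta: "mono (theta X dX dY f)"
  unfolding theta_def
  by (intro monoI Sup_subset_mono) (blast intro: less_le_trans ennreal_leI)

lemma mono_theta_min: "mono (theta_min X dX dY f g)"
  using mono_theta[of X dX dY f] mono_theta[of X dX dY g]
  unfolding theta_min_def mono_def by (meson min.mono)

lemma mono_tendsto_at_right_INF:
  fixes h :: "real \<Rightarrow> ennreal"
  assumes "mono h"
  shows "(h \<longlongrightarrow> (INF e\<in>{a<..}. h e)) (at_right a)"
proof (rule order_tendstoI)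
  fix l assume l: "l < (INF e\<in>{a<..}. h e)"
  have "l < h e" if "e > a" for e
    using l INF_lower[of e "{a<..}" h] that by (auto intro: less_le_trans)
  then show "\<forall>\<^sub>F e in at_right a. l < h e"
    by (auto simp: eventually_at_filter)
next
  fix u assume "(INF e\<in>{a<..}. h e) < u"
  then obtain b where b: "b > a" "h b < u"
    by (auto simp: INF_less_iff)
  have "h e < u" if "e < b" for e
    using monoD[OF assms, of e b] b(2) that by auto
  then show "\<forall>\<^sub>F e in at_right a. h e < u"
    using b(1) by (auto simp: eventually_at_right_field)
qed

lemma theta_min_tendsto_theta_plus:
  assumes "a \<ge> 0"
  shows "(theta_min X dX dY f g \<longlongrightarrow> theta_plus X dX dY f g (ennreal a)) (at_right a)"
proof -
  note lim = mono_tendsto_at_right_INF[OF mono_theta_min, of X dX dY f g a]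
  show ?thesis
    using lim tendsto_Lim[OF trivial_limit_at_right_real lim] assms by (simp add: theta_plus_def)
qed

text \<open>When \<open>a\<close> and \<open>b\<close> are both infinite the difference is \<open>0\<close>, but \<open>b\<close> alone already dominates \<open>a\<close>;
  so the convention \<open>\<infinity> - \<infinity> = 0\<close> does no harm to bounds by the distortion.\<close>

lemma le_add_abs_diff: "a \<le> b + abs_diff a b"
proof (cases "a \<le> b")
  case True
  then show ?thesis by (simp add: add_increasing2)
next
  case False
  then have "a = b + (a - b)" by (simp add: add_diff_inverse_ennreal)
  also have "\<dots> \<le> b + abs_diff a b"
    using False by (intro add_left_mono) (auto simp: abs_diff_def)
  finally show ?thesis .
qed

lemma theta_le_distortion: "theta X dX dY f e \<le> ennreal e + distortion X dX dY f"
  unfolding theta_def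
proof (rule Sup_least, clarify)
  fix x1 x2 assume x: "x1 \<in> X" "x2 \<in> X" "dX x1 x2 < ennreal e"
  have "dY (f x1) (f x2) \<le> dX x1 x2 + abs_diff (dY (f x1) (f x2)) (dX x1 x2)"
    by (rule le_add_abs_diff)
  also have "\<dots> \<le> ennreal e + distortion X dX dY f"
    unfolding distortion_def using x
    by (intro add_mono SUP_upper2[of x1] SUP_upper2[of x2]) auto
  finally show "dY (f x1) (f x2) \<le> ennreal e + distortion X dX dY f" .
qed

lemma theta_plus_le_distortion:
  assumes "a \<noteq> \<infinity>"
  shows "theta_plus X dX dY f g a \<le> a + min (distortion X dX dY f) (distortion X dX dY g)"
proof -
  obtain r where r: "r \<ge> 0" "a = ennreal r"
    using assms by (cases a) auto
  let ?D = "min (distortion X dX dY f) (distortion X dX dY g)"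
  have "\<forall>e. theta_min X dX dY f g e \<le> ennreal e + ?D"
    using theta_le_distortion[of X dX dY f] theta_le_distortion[of X dX dY g]
    by (simp add: theta_min_def min_def) (meson linear order_trans)
  moreover have "((\<lambda>e. ennreal e + ?D) \<longlongrightarrow> ennreal r + ?D) (at_right r)"
    by (intro tendsto_intros tendsto_ennrealI)
  ultimately show ?thesis
    unfolding r(2)
    by (intro tendsto_le[OF trivial_limit_at_right_real _ theta_min_tendsto_theta_plus[OF r(1)]])
      auto
qed

section \<open>Comparison of the two distances\<close>

text \<open>The detour \<open>f x\<close>, \<open>g x'\<close>, \<open>g x\<close> through a nearby graph point has a first leg shorter than \<open>e\<close>
  and a second leg bounded by the modulus of \<open>g\<close>; the ultrametric takes their maximum, not their
  sum.\<close>

lemma pointwise_dist_le_theta: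
  assumes Y: "nonarch_metric Y dY" and X: "ext_metric X dX"
    and fg: "f \<in> X \<rightarrow> Y" "g \<in> X \<rightarrow> Y"
    and e: "rho_H X dX dY f g < ennreal e" and x: "x \<in> X"
  shows "dY (f x) (g x) \<le> max (ennreal e) (theta X dX dY g e)"
proof -
  obtain x' where x': "x' \<in> X" "dX x x' < ennreal e" "dY (f x) (g x') < ennreal e"
    by (rule rho_H_close_point[OF e x])
  have "dX x' x < ennreal e"
    using x' x ext_metric.commute[OF X] by metis
  then have "dY (g x') (g x) \<le> theta X dX dY g e"
    by (rule theta_upper[OF x'(1) x])
  moreover have "dY (f x) (g x) \<le> max (dY (f x) (g x')) (dY (g x') (g x))"
    using fg x x'(1) by (intro nonarch_metric.ultrametric[OF Y]) auto
  ultimately show ?thesis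
    using x'(3) by (meson max.mono less_imp_le order_trans)
qed

text \<open>Both distances are symmetric in the two maps, so the pointwise estimate holds with the modulus
  of either one.\<close>

lemma rho_s_le_theta_min:
  assumes Y: "nonarch_metric Y dY" and X: "ext_metric X dX"
    and fg: "f \<in> X \<rightarrow> Y" "g \<in> X \<rightarrow> Y" and e: "rho_H X dX dY f g < ennreal e"
  shows "rho_s X dY f g \<le> max (ennreal e) (theta_min X dX dY f g e)"
proof -
  have "rho_s X dY f g \<le> max (ennreal e) (theta X dX dY g e)"
    unfolding rho_s_def using pointwise_dist_le_theta[OF Y X fg e] by (rule SUP_least)
  moreover have "rho_s X dY g f \<le> max (ennreal e) (theta X dX dY f e)"
    unfolding rho_s_def using e
    by (intro SUP_least pointwise_dist_le_theta[OF Y X fg(2,1)]) (simp_all add: rho_H_commute)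
  moreover have "rho_s X dY g f = rho_s X dY f g"
    using Y fg by (intro rho_s_commute) (auto simp: nonarch_metric_def)
  ultimately show ?thesis
    by (auto simp: theta_min_def min_def)
qed

text \<open>The preceding estimate needs a real \<open>e\<close> strictly above the Hausdorff distance, which is why a
  right-hand limit appears; at an infinite distance there is no such \<open>e\<close>, and the convention
  \<open>theta_plus \<infinity> = \<infinity>\<close> makes the bound trivial.\<close>

lemma rho_s_le_theta_plus:
  assumes Y: "nonarch_metric Y dY" and X: "ext_metric X dX"
    and fg: "f \<in> X \<rightarrow> Y" "g \<in> X \<rightarrow> Y"
  defines "a \<equiv> rho_H X dX dY f g"
  shows "rho_s X dY f g \<le> max (theta_plus X dX dY f g a) a"
proof (cases "a = \<infinity>")
  case True
  then show ?thesis by simp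
next
  case False
  then obtain r where r: "r \<ge> 0" "a = ennreal r"
    by (cases a) auto
  have lim: "((\<lambda>e. max (ennreal e) (theta_min X dX dY f g e))
      \<longlongrightarrow> max (ennreal r) (theta_plus X dX dY f g (ennreal r))) (at_right r)"
    by (intro tendsto_max tendsto_ennrealI tendsto_ident_at theta_min_tendsto_theta_plus r(1))
  have "\<forall>\<^sub>F e in at_right r. rho_s X dY f g \<le> max (ennreal e) (theta_min X dX dY f g e)"
    using rho_s_le_theta_min[OF Y X fg] r
    by (auto simp: eventually_at_filter a_def ennreal_less_iff)
  then have "rho_s X dY f g \<le> max (ennreal r) (theta_plus X dX dY f g (ennreal r))"
    by (rule tendsto_lowerbound[OF lim]) simp
  then show ?thesis by (simp add: r(2) max.commute)
qed

section \<open>Uniform convergence\<close>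

lemma converges_uniformly_imp_rho_H:
  assumes X: "ext_metric X dX" and Y: "ext_metric Y dY"
    and F: "\<And>n. n \<ge> 1 \<Longrightarrow> F n \<in> X \<rightarrow> Y" and g: "g \<in> X \<rightarrow> Y"
    and conv: "converges_uniformly X dY F g"
  shows "(\<lambda>n. rho_H X dX dY (F n) g) \<longlonglongrightarrow> 0"
proof (rule order_tendstoI)
  fix u :: ennreal assume "0 < u"
  \<comment> \<open>Bounds below a real \<open>e < u\<close> keep the supremum strictly below \<open>u\<close>.\<close>
  then obtain w where "0 < w" "w < u"
    using dense by blast
  then obtain e where e: "e > 0" "ennreal e < u"
    by (cases w) auto
  obtain N where N: "\<And>n x. n \<ge> N \<Longrightarrow> x \<in> X \<Longrightarrow> dY (F n x) (g x) < ennreal e"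
    using conv e(1) unfolding converges_uniformly_def by blast
  have "rho_H X dX dY (F n) g < u" if n: "n \<ge> max N 1" for n
  proof -
    have "rho_H X dX dY (F n) g \<le> rho_s X dY (F n) g"
      using n by (intro rho_H_le_rho_s[OF X Y F g]) simp
    also have "\<dots> \<le> ennreal e"
      unfolding rho_s_def using N n by (intro SUP_least less_imp_le) auto
    finally show ?thesis using e(2) by simp
  qed
  then show "\<forall>\<^sub>F n in sequentially. rho_H X dX dY (F n) g < u"
    unfolding eventually_sequentially by blast
qed simp

text \<open>The detour through a nearby graph point again, now with \<open>rho_H < min \<delta> e\<close>: the part below \<open>\<delta>\<close>
  activates the uniform continuity of \<open>g\<close>, and the part below \<open>e\<close> bounds the first leg.\<close>

lemma rho_H_imp_converges_uniformly:
  assumes X: "ext_metric X dX" and Y: "nonarch_metric Y dY"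
    and F: "\<And>n. n \<ge> 1 \<Longrightarrow> F n \<in> X \<rightarrow> Y" and g: "g \<in> unif_cont_maps X dX Y dY"
    and lim: "(\<lambda>n. rho_H X dX dY (F n) g) \<longlonglongrightarrow> 0"
  shows "converges_uniformly X dY F g"
  unfolding converges_uniformly_def
proof (intro allI impI)
  fix e :: real assume "e > 0"
  have gY: "g \<in> X \<rightarrow> Y"
    using g by (simp add: unif_cont_maps_def)
  obtain \<delta> where \<delta>: "\<delta> > 0"
    "\<And>x1 x2. \<lbrakk>x1 \<in> X; x2 \<in> X; dX x1 x2 < ennreal \<delta>\<rbrakk> \<Longrightarrow> dY (g x1) (g x2) < ennreal e"
    using g \<open>e > 0\<close> unfolding unif_cont_maps_def by blast
  have "0 < ennreal (min \<delta> e)"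
    using \<delta>(1) \<open>e > 0\<close> by simp
  from order_tendstoD(2)[OF lim this] obtain N where
    N: "\<And>n. n \<ge> N \<Longrightarrow> rho_H X dX dY (F n) g < ennreal (min \<delta> e)"
    unfolding eventually_sequentially by blast
  have "dY (F n x) (g x) < ennreal e" if n: "n \<ge> max N 1" and x: "x \<in> X" for n x
  proof -
    have "rho_H X dX dY (F n) g < ennreal (min \<delta> e)"
      using N n by simp
    then obtain x' where x': "x' \<in> X" "dX x x' < ennreal (min \<delta> e)"
        "dY (F n x) (g x') < ennreal (min \<delta> e)"
      by (rule rho_H_close_point[OF _ x])
    have small: "ennreal (min \<delta> e) \<le> ennreal \<delta>" "ennreal (min \<delta> e) \<le> ennreal e"
      by (auto intro: ennreal_leI)
    have "dX x' x < ennreal \<delta>"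
      using x'(2) small(1) ext_metric.commute[OF X x'(1) x] by simp
    then have "dY (g x') (g x) < ennreal e"
      by (rule \<delta>(2)[OF x'(1) x])
    moreover have "dY (F n x) (g x') < ennreal e"
      using x'(3) small(2) by (rule less_le_trans)
    moreover have "dY (F n x) (g x) \<le> max (dY (F n x) (g x')) (dY (g x') (g x))"
      using F[of n] gY n x x'(1) by (intro nonarch_metric.ultrametric[OF Y]) auto
    ultimately show ?thesis
      by (auto intro: le_less_trans)
  qed
  then show "\<exists>N. \<forall>n\<ge>N. \<forall>x\<in>X. dY (F n x) (g x) < ennreal e"
    by blast
qed

section \<open>The comparison theorem\<close>

theorem theorem3p2:
  fixes X :: "'a set" and dX :: "'a \<Rightarrow> 'a \<Rightarrow> ennreal"
    and Y :: "'b set" and dY :: "'b \<Rightarrow> 'b \<Rightarrow> ennreal"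
  assumes "nonarch_metric X dX" and "nonarch_metric Y dY"
  shows "(\<forall>f \<in> X \<rightarrow> Y. \<forall>g \<in> X \<rightarrow> Y.
            rho_H X dX dY f g \<le> rho_s X dY f g \<and>
            rho_s X dY f g \<le> max (theta_plus X dX dY f g (rho_H X dX dY f g)) (rho_H X dX dY f g) \<and>
            theta_plus X dX dY f g (rho_H X dX dY f g)
              \<le> rho_H X dX dY f g + min (distortion X dX dY f) (distortion X dX dY g)) \<and>
         (\<forall>F :: nat \<Rightarrow> 'a \<Rightarrow> 'b. \<forall>g \<in> unif_cont_maps X dX Y dY.
            (\<forall>n\<ge>1. F n \<in> X \<rightarrow> Y) \<longrightarrow>
            (converges_uniformly X dY F g \<longleftrightarrow> (\<lambda>n. rho_H X dX dY (F n) g) \<longlonglongrightarrow> 0))"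
proof (intro conjI ballI allI impI)
  have X: "ext_metric X dX" and Y: "ext_metric Y dY"
    using assms by (simp_all add: nonarch_metric_def)
  {
    fix f g assume fg: "f \<in> X \<rightarrow> Y" "g \<in> X \<rightarrow> Y"
    show "rho_H X dX dY f g \<le> rho_s X dY f g"
      by (rule rho_H_le_rho_s[OF X Y fg])
    show "rho_s X dY f g \<le> max (theta_plus X dX dY f g (rho_H X dX dY f g)) (rho_H X dX dY f g)"
      by (rule rho_s_le_theta_plus[OF assms(2) X fg])
    show "theta_plus X dX dY f g (rho_H X dX dY f g)
        \<le> rho_H X dX dY f g + min (distortion X dX dY f) (distortion X dX dY g)"
      by (cases "rho_H X dX dY f g = \<infinity>") (simp, rule theta_plus_le_distortion)
  next
    fix F :: "nat \<Rightarrow> 'a \<Rightarrow> 'b" and g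
    assume g: "g \<in> unif_cont_maps X dX Y dY" and F: "\<forall>n\<ge>1. F n \<in> X \<rightarrow> Y"
    have "g \<in> X \<rightarrow> Y"
      using g by (simp add: unif_cont_maps_def)
    then show "converges_uniformly X dY F g \<longleftrightarrow> (\<lambda>n. rho_H X dX dY (F n) g) \<longlonglongrightarrow> 0"
      using converges_uniformly_imp_rho_H[OF X Y, of F g]
        rho_H_imp_converges_uniformly[OF X assms(2) _ g, of F] F by blast
  }
qed

end
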